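(* Let $\epsilon>0$ and let $s$ be a real number with $0<s<1$. Then there exists $N$ such that for every even integer $n\ge N$, $$2\left(n-\tfrac{1}{2}\right)^s < A_{n,s}^{-1} < 2\left(n-\tfrac{1}{2}+\epsilon\right)^s,$$ and for every odd integer $n\ge N$, $$-2\left(n-\tfrac{1}{2}+\epsilon\right)^s < B_{n,s}^{-1} \le -2\left(n-\tfrac{1}{2}\right)^s.$$
   Context: For a positive integer $n$ and real $0<s<1$, define $A_{n,s} = \sum_{j=0}^{\infty}\left(\frac{1}{(n+2j)^s}-\frac{1}{(n+2j+1)^s}\right)$ and $B_{n,s} = \sum_{j=0}^{\infty}\left(-\frac{1}{(n+2j)^s}+\frac{1}{(n+2j+1)^s}\right)$. Here $A_{n,s}^{-1}$ denotes $1/A_{n,s}$ and similarly for $B$. *)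

theory Defs
  imports "HOL-Analysis.Analysis"
begin

(* For n > 0 and 0 < s < 1 both series converge, since their terms are O(j powr (-s - 1)),
   so suminf is their genuine sum. *)

definition A :: "nat \<Rightarrow> real \<Rightarrow> real" where
  "A n s = (\<Sum>j. 1 / real (n + 2 * j) powr s - 1 / real (n + 2 * j + 1) powr s)"

definition B :: "nat \<Rightarrow> real \<Rightarrow> real" where
  "B n s = (\<Sum>j. - (1 / real (n + 2 * j) powr s) + 1 / real (n + 2 * j + 1) powr s)"

end

theory Submission
  imports Defs "HOL-Real_Asymp.Real_Asymp"
begin

text \<open>
  Write \<open>f x = x powr -s\<close>, so that \<open>A n s\<close> is the sum of the differences
  \<open>f x - f (x + 1)\<close> over \<open>x = n, n + 2, \<dots>\<close> and \<open>B n s = - A n s\<close>.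
  By strict convexity of \<open>-f'\<close>, the mean of \<open>-f'\<close> over an interval of length 1 is smaller than
  its mean over the interval of length 2 with the same midpoint, which says
  \<open>f x - f (x + 1) < (f (x - 1/2) - f (x + 3/2)) / 2\<close>.
  Conversely, shifting the long interval by any \<open>\<epsilon> > 0\<close> to the right reverses this inequality
  for large \<open>x\<close>, since the gain is of order \<open>x powr (-s-2)\<close> and the
  convexity defect only of order \<open>x powr (-s-3)\<close>. Both bounds telescope.
\<close>

text \<open>The derivative in \<open>t\<close> is \<open>-q > 0\<close> times the drop of a strictly
  decreasing power from \<open>c - t\<close> to \<open>c + t\<close>, hence positive for
  \<open>t > 0\<close>. This is the form in which convexity is used below.\<close>

lemma powr_symmetric_sum_strict_mono:
  fixes c q u v :: real
  assumes "q < 0" "0 \<le> u" "u < v" "v < c"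
  shows "(c - u) powr q + (c + u) powr q < (c - v) powr q + (c + v) powr q"
proof (rule DERIV_pos_imp_increasing_open[OF \<open>u < v\<close>])
  fix t assume t: "u < t" "t < v"
  have "((\<lambda>t. (c - t) powr q + (c + t) powr q) has_real_derivative
      -q * ((c - t) powr (q - 1) - (c + t) powr (q - 1))) (at t)"
    using t assms by (auto intro!: derivative_eq_intros simp: algebra_simps)
  moreover have "(c + t) powr (q - 1) < (c - t) powr (q - 1)"
    using t assms by (intro powr_less_mono2_neg) auto
  ultimately show "\<exists>y. ((\<lambda>t. (c - t) powr q + (c + t) powr q) has_real_derivative y) (at t) \<and> 0 < y"
    using mult_pos_pos[of "-q" "(c - t) powr (q - 1) - (c + t) powr (q - 1)"] \<open>q < 0\<close>
    by (intro exI[of _ "-q * ((c - t) powr (q - 1) - (c + t) powr (q - 1))"]) auto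
next
  show "continuous_on {u..v} (\<lambda>t. (c - t) powr q + (c + t) powr q)"
    using assms by (intro continuous_intros) auto
qed

text \<open>Mean value theorem in the half-width of an interval with fixed midpoint
  \<open>c\<close>; the derivative is a symmetric sum, so the previous lemma compares its
  values.\<close>

lemma powr_symmetric_diff_MVT:
  fixes c s u v :: real
  assumes "0 \<le> u" "u < v" "v < c"
  obtains t where "u < t" "t < v"
    "((c - v) powr -s - (c + v) powr -s) - ((c - u) powr -s - (c + u) powr -s) =
      (v - u) * (s * ((c - t) powr (-s-1) + (c + t) powr (-s-1)))"
proof -
  have "((\<lambda>t. (c - t) powr -s - (c + t) powr -s) has_real_derivative
      s * ((c - t) powr (-s-1) + (c + t) powr (-s-1))) (at t)" if "u \<le> t" "t \<le> v" for t
    using that assms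
    by (auto intro!: derivative_eq_intros simp: algebra_simps minus_diff_commute)
  from MVT2[OF \<open>u < v\<close> this] show ?thesis
    using that by blast
qed

lemma powr_diff_less_wide_diff:
  fixes s x :: real
  assumes "s > 0" "x > 1/2"
  shows "x powr -s - (x+1) powr -s < ((x - 1/2) powr -s - (x - 1/2 + 2) powr -s) / 2"
proof -
  \<comment> \<open>Common midpoint of both intervals. With D(h) = (c - h) powr -s - (c + h) powr -s
    the goal is 2 D(1/2) < D(1). As D(0) = 0, it suffices that D grows more on [1/2, 1] than on
    [0, 1/2].\<close>
  let ?c = "x + 1/2"
  obtain t where t: "0 < t" "t < 1/2"
    "((?c - 1/2) powr -s - (?c + 1/2) powr -s) - ((?c - 0) powr -s - (?c + 0) powr -s) =
      (1/2 - 0) * (s * ((?c - t) powr (-s-1) + (?c + t) powr (-s-1)))"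
    by (rule powr_symmetric_diff_MVT[of 0 "1/2" ?c s]) (use assms in auto)
  obtain r where r: "1/2 < r" "r < 1"
    "((?c - 1) powr -s - (?c + 1) powr -s) - ((?c - 1/2) powr -s - (?c + 1/2) powr -s) =
      (1 - 1/2) * (s * ((?c - r) powr (-s-1) + (?c + r) powr (-s-1)))"
    by (rule powr_symmetric_diff_MVT[of "1/2" 1 ?c s]) (use assms in auto)
  have "s * ((?c - t) powr (-s-1) + (?c + t) powr (-s-1)) <
        s * ((?c - r) powr (-s-1) + (?c + r) powr (-s-1))"
    using assms t r by (intro mult_strict_left_mono powr_symmetric_sum_strict_mono) auto
  with t(3) r(3) show ?thesis
    by (simp add: algebra_simps)
qed

lemma eventually_shifted_wide_diff_less_powr_diff:
  fixes s \<epsilon> :: real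
  assumes "s > 0" "\<epsilon> > 0"
  shows "eventually (\<lambda>x. ((x - 1/2 + \<epsilon>) powr -s - (x - 1/2 + \<epsilon> + 2) powr -s) / 2
    < x powr -s - (x+1) powr -s) at_top"
proof -
  define p where "p = s + 1"
  have "p > 0"
    using assms by (simp add: p_def)
  \<comment> \<open>Here \<open>d\<close> stands for the midpoint of the shifted long interval and
    \<open>d - \<epsilon>\<close> for that of the unit interval. Relative to 2 d powr -p, the right
    side gains order d powr (-p-1), the left only d powr (-p-2).\<close>
  then have "eventually (\<lambda>d. (d - 1) powr -p + (d + 1) powr -p < 2 * (d - \<epsilon>) powr -p) at_top"
    using \<open>\<epsilon> > 0\<close> by real_asymp
  moreover have "filterlim (\<lambda>x. x + 1/2 + \<epsilon>) at_top at_top"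
    by real_asymp
  ultimately have "eventually (\<lambda>x. (x + 1/2 + \<epsilon> - 1) powr -p + (x + 1/2 + \<epsilon> + 1) powr -p
      < 2 * (x + 1/2 + \<epsilon> - \<epsilon>) powr -p) at_top"
    by (rule eventually_compose_filterlim)
  then show ?thesis
    using eventually_gt_at_top[of 1]
  proof eventually_elim
    case (elim x)
    let ?c = "x + 1/2"
    obtain t where t: "0 < t" "t < 1/2"
      "((?c - 1/2) powr -s - (?c + 1/2) powr -s) - ((?c - 0) powr -s - (?c + 0) powr -s) =
        (1/2 - 0) * (s * ((?c - t) powr (-s-1) + (?c + t) powr (-s-1)))"
      by (rule powr_symmetric_diff_MVT[of 0 "1/2" ?c s]) (use elim in auto)
    let ?d = "?c + \<epsilon>"
    obtain r where r: "0 < r" "r < 1"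
      "((?d - 1) powr -s - (?d + 1) powr -s) - ((?d - 0) powr -s - (?d + 0) powr -s) =
        (1 - 0) * (s * ((?d - r) powr (-s-1) + (?d + r) powr (-s-1)))"
      by (rule powr_symmetric_diff_MVT[of 0 1 ?d s]) (use elim assms in auto)
    \<comment> \<open>The mean value points are unknown, so each is pushed to its worst case,
      \<open>r\<close> to 1 and \<open>t\<close> to 0; the asymptotic inequality joins the
      two.\<close>
    have "s * ((?d - r) powr (-s-1) + (?d + r) powr (-s-1)) <
          s * ((?d - 1) powr (-s-1) + (?d + 1) powr (-s-1))"
      using assms elim r by (intro mult_strict_left_mono powr_symmetric_sum_strict_mono) auto
    also have "\<dots> < s * (2 * ?c powr (-s-1))"
      using elim assms by (intro mult_strict_left_mono) (simp_all add: p_def)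
    also have "\<dots> = s * ((?c - 0) powr (-s-1) + (?c + 0) powr (-s-1))"
      by simp
    also have "\<dots> < s * ((?c - t) powr (-s-1) + (?c + t) powr (-s-1))"
      using assms elim t by (intro mult_strict_left_mono powr_symmetric_sum_strict_mono) auto
    finally show ?case
      using t(3) r(3) by (simp add: algebra_simps)
  qed
qed

lemma suminf_less_telescope:
  fixes d g :: "nat \<Rightarrow> real"
  assumes "g \<longlonglongrightarrow> 0" "\<And>j. 0 \<le> d j" "\<And>j. d j < g j - g (Suc j)"
  shows "summable d" "suminf d < g 0"
proof -
  have g: "(\<lambda>j. g j - g (Suc j)) sums g 0"
    using telescope_sums'[OF assms(1)] by simp
  show d: "summable d"
    by (rule summable_comparison_test'[OF sums_summable[OF g], of 0])
       (use assms(2,3) in \<open>auto intro: less_imp_le\<close>)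
  \<comment> \<open>Summing the positive gaps keeps the inequality strict; a termwise comparison of
    limits would only give \<le>.\<close>
  have "0 < (\<Sum>j. (g j - g (Suc j)) - d j)"
    using assms(3) by (intro suminf_pos summable_diff sums_summable[OF g] d) simp
  also have "\<dots> = g 0 - suminf d"
    using suminf_diff[OF sums_summable[OF g] d] sums_unique[OF g] by simp
  finally show "suminf d < g 0"
    by simp
qed

lemma telescope_less_suminf:
  fixes d g :: "nat \<Rightarrow> real"
  assumes "g \<longlonglongrightarrow> 0" "summable d" "\<And>j. g j - g (Suc j) < d j"
  shows "g 0 < suminf d"
proof -
  have g: "(\<lambda>j. g j - g (Suc j)) sums g 0"
    using telescope_sums'[OF assms(1)] by simp
  have "0 < (\<Sum>j. d j - (g j - g (Suc j)))"
    using assms(3) by (intro suminf_pos summable_diff sums_summable[OF g] assms(2)) simp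
  also have "\<dots> = suminf d - g 0"
    using suminf_diff[OF assms(2) sums_summable[OF g]] sums_unique[OF g] by simp
  finally show ?thesis
    by simp
qed

lemma half_powr_tendsto_0:
  fixes s e :: real
  assumes "s > 0"
  shows "(\<lambda>j. (real (n + 2 * j) - 1/2 + e) powr -s / 2) \<longlonglongrightarrow> 0"
  using assms by real_asymp

lemma A_eq: "A n s = (\<Sum>j. real (n + 2 * j) powr -s - (real (n + 2 * j) + 1) powr -s)"
  unfolding A_def by (simp add: powr_minus_divide add.commute)

lemma A_summable_less:
  fixes s :: real
  assumes "s > 0" "n > 0"
  shows "summable (\<lambda>j. real (n + 2 * j) powr -s - (real (n + 2 * j) + 1) powr -s)"
    and "A n s < (real n - 1/2) powr -s / 2"
proof -
  let ?d = "\<lambda>j. real (n + 2 * j) powr -s - (real (n + 2 * j) + 1) powr -s"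
  \<comment> \<open>The \<open>+ 0\<close> makes \<open>?g\<close> an instance of
    \<open>half_powr_tendsto_0\<close>. The long interval has length 2, the step of the series, so
    the bounds telescope.\<close>
  let ?g = "\<lambda>j. (real (n + 2 * j) - 1/2 + 0) powr -s / 2"
  have d: "0 \<le> ?d j" for j
    using assms by (simp add: powr_mono2')
  have less: "?d j < ?g j - ?g (Suc j)" for j
    using powr_diff_less_wide_diff[of s "real (n + 2 * j)"] assms
    by (simp add: diff_divide_distrib algebra_simps)
  note * = suminf_less_telescope[of ?g ?d, OF half_powr_tendsto_0[OF \<open>s > 0\<close>] d less]
  show "summable ?d"
    by (rule *)
  show "A n s < (real n - 1/2) powr -s / 2"
    using *(2) by (simp add: A_eq)
qed

lemma eventually_less_A:
  fixes s \<epsilon> :: real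
  assumes "s > 0" "\<epsilon> > 0"
  shows "eventually (\<lambda>n. (real n - 1/2 + \<epsilon>) powr -s / 2 < A n s) sequentially"
proof -
  from eventually_shifted_wide_diff_less_powr_diff[OF assms] obtain X where
    X: "\<And>x. x \<ge> X \<Longrightarrow> ((x - 1/2 + \<epsilon>) powr -s - (x - 1/2 + \<epsilon> + 2) powr -s) / 2
      < x powr -s - (x+1) powr -s"
    by (auto simp: eventually_at_top_linorder)
  have "eventually (\<lambda>n. real n \<ge> X) sequentially"
    by real_asymp
  then show ?thesis
    using eventually_gt_at_top[of 0]
  proof eventually_elim
    case (elim n)
    let ?d = "\<lambda>j. real (n + 2 * j) powr -s - (real (n + 2 * j) + 1) powr -s"
    let ?g = "\<lambda>j. (real (n + 2 * j) - 1/2 + \<epsilon>) powr -s / 2"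
    \<comment> \<open>One threshold on \<open>n\<close> serves every \<open>j\<close>, since n + 2j
      \<ge> n \<ge> X.\<close>
    have "?g j - ?g (Suc j) < ?d j" for j
      using X[of "real (n + 2 * j)"] elim(1)
      by (simp add: diff_divide_distrib algebra_simps)
    from telescope_less_suminf[of ?g ?d, OF half_powr_tendsto_0[OF \<open>s > 0\<close>]
        A_summable_less(1)[OF \<open>s > 0\<close> elim(2)] this]
    show ?case
      by (simp add: A_eq)
  qed
qed

lemma B_eq_uminus_A:
  assumes "s > 0" "n > 0"
  shows "B n s = - A n s"
proof -
  have "summable (\<lambda>j. 1 / real (n + 2 * j) powr s - 1 / real (n + 2 * j + 1) powr s)"
    using A_summable_less(1)[OF assms] by (simp add: powr_minus_divide add.commute)
  from suminf_minus[OF this] show ?thesis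
    by (simp add: A_def B_def)
qed

theorem theorem2p6:
  fixes \<epsilon> s :: real
  assumes "\<epsilon> > 0" and "0 < s" and "s < 1"
  shows "\<exists>N::nat. N > 0 \<and>
    (\<forall>n\<ge>N. even n \<longrightarrow>
       2 * (real n - 1 / 2) powr s < 1 / A n s \<and>
       1 / A n s < 2 * (real n - 1 / 2 + \<epsilon>) powr s) \<and>
    (\<forall>n\<ge>N. odd n \<longrightarrow>
       - 2 * (real n - 1 / 2 + \<epsilon>) powr s < 1 / B n s \<and>
       1 / B n s \<le> - 2 * (real n - 1 / 2) powr s)"
proof -
  obtain M where M: "\<And>n. n \<ge> M \<Longrightarrow> (real n - 1/2 + \<epsilon>) powr -s / 2 < A n s"
    using eventually_less_A[OF assms(2,1)] by (auto simp: eventually_sequentially)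
  \<comment> \<open>\<open>Suc M\<close> forces \<open>n > 0\<close>, so that
    \<open>real n - 1/2\<close> is positive and the upper bound on \<open>A\<close> applies.\<close>
  have bounds: "2 * (real n - 1/2) powr s < 1 / A n s"
    "1 / A n s < 2 * (real n - 1/2 + \<epsilon>) powr s" if "n \<ge> Suc M" for n
  proof -
    have pos: "(real n - 1/2) powr s > 0" "(real n - 1/2 + \<epsilon>) powr s > 0"
      using that \<open>\<epsilon> > 0\<close> by auto
    have lower: "1 / (2 * (real n - 1/2 + \<epsilon>) powr s) < A n s"
      using M[of n] that by (simp add: powr_minus_divide mult.commute)
    have upper: "A n s < 1 / (2 * (real n - 1/2) powr s)"
      using A_summable_less(2)[OF \<open>0 < s\<close>, of n] that by (simp add: powr_minus_divide mult.commute)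
    have "A n s > 0"
      using pos by (intro less_trans[OF _ lower]) simp
    then show "2 * (real n - 1/2) powr s < 1 / A n s"
      "1 / A n s < 2 * (real n - 1/2 + \<epsilon>) powr s"
      using lower upper pos by (simp_all add: field_simps)
  qed
  moreover have "1 / B n s = - (1 / A n s)" if "n \<ge> Suc M" for n
    using B_eq_uminus_A[OF \<open>0 < s\<close>, of n] that by simp
  ultimately show ?thesis
    \<comment> \<open>The claim for \<open>B\<close> is the negation of \<open>bounds\<close>, with
      one strict inequality weakened to \<le>.\<close>
    by (intro exI[of _ "Suc M"]) (auto intro: less_imp_le)
qed

end
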